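(* Let $n\geq 4$. The graph $Q_n$ is a connected vertex-transitive CIS graph of order $4n$ and valency $7$ with $\alpha(Q_n)=n$ and $\omega(Q_n)=4$. Moreover, if $n$ is prime then $Q_n$ is not a Cayley graph.
   Context: All graphs are finite, simple and undirected. For $n\geq 3$, $Q_n$ is the graph with vertex set $\mathbb{Z}_n\times\mathbb{Z}_2\times\mathbb{Z}_2$ whose edges are: all pairs $\{(i,x,y),(i+1,y,z)\}$ with $i\in\mathbb{Z}_n$, $x,y,z\in\mathbb{Z}_2$; and all pairs $\{(i,x,y),(i,u,v)\}$ with $i\in\mathbb{Z}_n$, $x,y,u,v\in\mathbb{Z}_2$, $(x,y)\neq(u,v)$. A clique (respectively, stable set) is a set of pairwise adjacent (respectively, pairwise non-adjacent) vertices; "maximal" means maximal with respect to inclusion. $\omega(\Gamma)$ and $\alpha(\Gamma)$ denote the largest cardinality of a clique and of a stable set of $\Gamma$. A graph is CIS if every maximal stable set and every maximal clique have non-empty intersection. A graph has valency $k$ if every vertex has exactly $k$ neighbors. A graph is vertex-transitive if for every pair of vertices there is an automorphism mapping one to the other. For a group $G$ and an inverse-closed subset $S\subseteq G$ with $1\notin S$, the Cayley graph of $G$ with connection set $S$ has vertex set $G$, with $g,h$ adjacent if and only if $g^{-1}h\in S$; a graph is Cayley if it is isomorphic to some such graph. *)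

theory Defs
  imports
    "Graph_Theory.Graph_Theory"
    "HOL-Algebra.Group"
    "HOL-Computational_Algebra.Primes"
begin

text \<open>
  Finite simple undirected graphs are the \<^const>\<open>pair_graph\<close>s of the graph library: an edge
  \<open>{u, v}\<close> is represented by the two arcs \<open>(u, v)\<close> and \<open>(v, u)\<close>. Connectedness and isomorphism
  are the library's \<^const>\<open>Digraph_Component.connected\<close> and \<^const>\<open>digraph_iso\<close>.
\<close>

definition is_clique :: "'a pair_pre_digraph \<Rightarrow> 'a set \<Rightarrow> bool" where
  "is_clique \<Gamma> K \<longleftrightarrow> K \<subseteq> pverts \<Gamma> \<and> (\<forall>u\<in>K. \<forall>v\<in>K. u \<noteq> v \<longrightarrow> (u, v) \<in> parcs \<Gamma>)"

definition is_stable_set :: "'a pair_pre_digraph \<Rightarrow> 'a set \<Rightarrow> bool" where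
  "is_stable_set \<Gamma> S \<longleftrightarrow> S \<subseteq> pverts \<Gamma> \<and> (\<forall>u\<in>S. \<forall>v\<in>S. (u, v) \<notin> parcs \<Gamma>)"

definition is_maximal_clique :: "'a pair_pre_digraph \<Rightarrow> 'a set \<Rightarrow> bool" where
  "is_maximal_clique \<Gamma> K \<longleftrightarrow>
     is_clique \<Gamma> K \<and> (\<forall>K'. is_clique \<Gamma> K' \<and> K \<subseteq> K' \<longrightarrow> K' = K)"

definition is_maximal_stable_set :: "'a pair_pre_digraph \<Rightarrow> 'a set \<Rightarrow> bool" where
  "is_maximal_stable_set \<Gamma> S \<longleftrightarrow>
     is_stable_set \<Gamma> S \<and> (\<forall>S'. is_stable_set \<Gamma> S' \<and> S \<subseteq> S' \<longrightarrow> S' = S)"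

definition clique_number :: "'a pair_pre_digraph \<Rightarrow> nat" where
  "clique_number \<Gamma> = Max (card ` {K. is_clique \<Gamma> K})"

definition stability_number :: "'a pair_pre_digraph \<Rightarrow> nat" where
  "stability_number \<Gamma> = Max (card ` {S. is_stable_set \<Gamma> S})"

definition is_CIS :: "'a pair_pre_digraph \<Rightarrow> bool" where
  "is_CIS \<Gamma> \<longleftrightarrow>
     (\<forall>S K. is_maximal_stable_set \<Gamma> S \<and> is_maximal_clique \<Gamma> K \<longrightarrow> S \<inter> K \<noteq> {})"

definition has_valency :: "'a pair_pre_digraph \<Rightarrow> nat \<Rightarrow> bool" where
  "has_valency \<Gamma> k \<longleftrightarrow> (\<forall>v\<in>pverts \<Gamma>. card {w \<in> pverts \<Gamma>. (v, w) \<in> parcs \<Gamma>} = k)"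

definition is_vertex_transitive :: "'a pair_pre_digraph \<Rightarrow> bool" where
  "is_vertex_transitive \<Gamma> \<longleftrightarrow>
     (\<forall>u\<in>pverts \<Gamma>. \<forall>v\<in>pverts \<Gamma>.
        \<exists>f. pre_digraph.digraph_isomorphism (with_proj \<Gamma>) f
          \<and> app_iso f (with_proj \<Gamma>) = with_proj \<Gamma>
          \<and> iso_verts f u = v)"

definition cayley_graph :: "'g monoid \<Rightarrow> 'g set \<Rightarrow> 'g pair_pre_digraph" where
  "cayley_graph G S =
     \<lparr> pverts = carrier G,
       parcs = {(g, h). g \<in> carrier G \<and> h \<in> carrier G \<and> inv\<^bsub>G\<^esub> g \<otimes>\<^bsub>G\<^esub> h \<in> S} \<rparr>"

text \<open>
  HOL cannot quantify over types inside a definition, so the type \<open>'g\<close> carrying the group is a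
  parameter; a theorem with \<open>'g\<close> left as a free type variable covers groups over all types.
\<close>

definition is_cayley :: "'g itself \<Rightarrow> 'a pair_pre_digraph \<Rightarrow> bool" where
  "is_cayley (_ :: 'g itself) \<Gamma> \<longleftrightarrow>
     (\<exists>(G :: 'g monoid) S. group G \<and> S \<subseteq> carrier G \<and> (\<forall>s\<in>S. inv\<^bsub>G\<^esub> s \<in> S) \<and> \<one>\<^bsub>G\<^esub> \<notin> S
        \<and> digraph_iso (with_proj \<Gamma>) (with_proj (cayley_graph G S)))"

text \<open>\<open>\<int>\<^sub>n\<close> is represented by \<open>{..<n}\<close> with addition modulo \<open>n\<close>.\<close>

definition Q_edges :: "nat \<Rightarrow> (nat \<times> nat \<times> nat) set set" where
  "Q_edges n =
     {{(i, x, y), ((i + 1) mod n, y, z)} | i x y z. i < n \<and> x < 2 \<and> y < 2 \<and> z < 2} \<union>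
     {{(i, x, y), (i, u, v)} | i x y u v.
        i < n \<and> x < 2 \<and> y < 2 \<and> u < 2 \<and> v < 2 \<and> (x, y) \<noteq> (u, v)}"

definition Q :: "nat \<Rightarrow> (nat \<times> nat \<times> nat) pair_pre_digraph" where
  "Q n = \<lparr> pverts = {..<n} \<times> {..<2} \<times> {..<2}, parcs = {(a, b). {a, b} \<in> Q_edges n} \<rparr>"

lemma Q_pair_graph:
  assumes "n \<ge> 3"
  shows "pair_graph (Q n)"
proof -
  have wf: "a \<in> pverts (Q n) \<and> b \<in> pverts (Q n)" if "(a, b) \<in> parcs (Q n)" for a b
  proof -
    have "{a, b} \<in> Q_edges n"
      using that by (simp add: Q_def)
    moreover have "e \<subseteq> pverts (Q n)" if "e \<in> Q_edges n" for e
      using that assms unfolding Q_def Q_edges_def by auto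
    ultimately have "{a, b} \<subseteq> pverts (Q n)" by blast
    then show ?thesis by simp
  qed
  have eq: "p = q" if "{a} = {p, q}" for a p q :: "nat \<times> nat \<times> nat"
    using that by blast
  have irr: "(a, a) \<notin> parcs (Q n)" for a
  proof
    assume "(a, a) \<in> parcs (Q n)"
    then have "{a} \<in> Q_edges n" by (simp add: Q_def)
    then consider (1) i x y z where "i < n" "{a} = {(i, x, y), ((i + 1) mod n, y, z)}"
      | (2) i x y u v where "(x, y) \<noteq> (u, v)" "{a} = {(i, x, y), (i, u, v)}"
      unfolding Q_edges_def by blast
    then show False
    proof cases
      case 1
      have "(i + 1) mod n = i" using eq[OF 1(2)] by simp
      then show False using 1(1) assms by (cases "i + 1 = n") auto
    next
      case 2
      then show False using eq[OF 2(2)] by simp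
    qed
  qed
  have fin: "finite (pverts (Q n))" by (simp add: Q_def)
  have "finite (parcs (Q n))"
    by (rule finite_subset[of _ "pverts (Q n) \<times> pverts (Q n)"]) (use wf fin in auto)
  moreover have "symmetric (with_proj (Q n))"
    by (simp add: symmetric_def sym_def Q_def insert_commute)
  ultimately show ?thesis
    using wf irr fin by unfold_locales (auto simp del: with_proj_simps)
qed

lemma cayley_graph_bidirected:
  fixes G (structure)
  assumes "group G" "S \<subseteq> carrier G" "\<forall>s\<in>S. inv s \<in> S" "\<one> \<notin> S"
  shows "pair_bidirected_digraph (cayley_graph G S)"
proof -
  interpret group G by fact
  have "inv h \<otimes> g \<in> S" if "g \<in> carrier G" "h \<in> carrier G" "inv g \<otimes> h \<in> S" for g h
    using assms(3) that by (metis inv_closed inv_inv inv_mult_group)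
  then show ?thesis
    using assms(4) by unfold_locales (auto simp: cayley_graph_def symmetric_def sym_def)
qed

end

theory Submission
  imports Defs "HOL-Algebra.Sylow"
begin

text \<open>
  The maximal cliques of \<open>Q n\<close> are the layers \<open>{i} \<times> \<int>\<^sub>2 \<times> \<int>\<^sub>2\<close> and, for every \<open>i\<close> and \<open>y\<close>, the
  junctions \<open>{(i, x, y)} \<union> {(i + 1, y, z)}\<close>. A stable set has at most one vertex in each layer, so
  its two neighbouring layers can block at most three vertices of a layer; hence a maximal stable
  set meets every layer. Its vertices \<open>(i, a, b)\<close> and \<open>(i + 1, c, d)\<close> satisfy \<open>b \<noteq> c\<close>, so one of
  them lies in the junction given by \<open>i\<close> and \<open>y\<close>. Rotations together with the maps flipping all coordinates attached to a given junction level act transitively.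

  If \<open>Q n\<close> is a Cayley graph with \<open>n\<close> prime, a group \<open>G\<close> of order \<open>4 n\<close> acts regularly on it. Two
  distinct subgroups of order \<open>n \<ge> 5\<close> would produce at least \<open>n\<^sup>2 > 4 n\<close> elements, so the Sylow
  subgroup \<open>P\<close> of order \<open>n\<close> is normal. It permutes the layers regularly; let \<open>r \<in> P\<close> move layer \<open>0\<close>
  to layer \<open>1\<close>. Then \<open>r\<close> acts on the layers as the rotation by one. Since \<open>P\<close> is normal and \<open>G\<close> is
  transitive, either all vertices \<open>w\<close> of layer \<open>0\<close> are adjacent to \<open>r w\<close> or none is. In both cases
  \<open>r (0, 0, 0)\<close> and \<open>r (0, 1, 0)\<close> agree in their first bit, and they agree in the second bit because
  \<open>(0, 0, 0)\<close> and \<open>(0, 1, 0)\<close> have a common neighbour in layer \<open>1\<close>; so they coincide, which is absurd.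
\<close>

section \<open>Adjacency and valency\<close>

text \<open>An unordered pair fits a member of \<open>Q_edges\<close> in two orientations, so the
  cross-layer condition appears once for \<open>j\<close> following \<open>i\<close> and once for
  \<open>i\<close> following \<open>j\<close>.\<close>

lemma Q_arc_iff:
  assumes "n \<ge> 3"
  shows "((i, x, y), (j, u, v)) \<in> parcs (Q n) \<longleftrightarrow>
    i < n \<and> j < n \<and> x < 2 \<and> y < 2 \<and> u < 2 \<and> v < 2 \<and>
    (i = j \<and> (x, y) \<noteq> (u, v) \<or> j = (i + 1) mod n \<and> u = y \<or> i = (j + 1) mod n \<and> x = v)"
    (is "?L \<longleftrightarrow> ?R")
proof
  assume ?L
  then have "{(i, x, y), (j, u, v)} \<in> Q_edges n"
    by (simp add: Q_def)
  then show ?R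
    unfolding Q_edges_def
  proof (elim UnE CollectE exE conjE)
    fix i' x' y' z' :: nat
    assume *: "{(i, x, y), (j, u, v)} = {(i', x', y'), ((i' + 1) mod n, y', z')}"
      "i' < n" "x' < 2" "y' < 2" "z' < 2"
    then have "(i' + 1) mod n < n"
      by simp
    then show ?thesis
      using * by (auto simp: doubleton_eq_iff)
  next
    fix i' x' y' u' v' :: nat
    assume "{(i, x, y), (j, u, v)} = {(i', x', y'), (i', u', v')}"
      "i' < n" "x' < 2" "y' < 2" "u' < 2" "v' < 2" "(x', y') \<noteq> (u', v')"
    then show ?thesis
      by (auto simp: doubleton_eq_iff)
  qed
next
  assume R: ?R
  have 1: "{(k, a, b), ((k + 1) mod n, b, c)} \<in> Q_edges n" if "k < n" "a < 2" "b < 2" "c < 2" for k a b c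
    unfolding Q_edges_def by (intro UnI1 CollectI exI conjI, rule refl) (use that in simp_all)
  have 2: "{(k, a, b), (k, c, d)} \<in> Q_edges n"
    if "k < n" "a < 2" "b < 2" "c < 2" "d < 2" "(a, b) \<noteq> (c, d)" for k a b c d
    unfolding Q_edges_def by (intro UnI2 CollectI exI conjI, rule refl) (use that in simp_all)
  have "{(i, x, y), (j, u, v)} \<in> Q_edges n"
    using R 1[of i x y v] 1[of j u v y] 2[of i x y u v] by (auto simp: insert_commute)
  then show ?L
    by (simp add: Q_def)
qed

lemma Q_verts_iff: "(i, x, y) \<in> pverts (Q n) \<longleftrightarrow> i < n \<and> x < 2 \<and> y < 2"
  by (simp add: Q_def)

lemma Q_arc_sym: "(u, v) \<in> parcs (Q n) \<Longrightarrow> (v, u) \<in> parcs (Q n)"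
  by (simp add: Q_def insert_commute)

lemma Q_arc_verts:
  assumes "n \<ge> 3" "(u, v) \<in> parcs (Q n)"
  shows "u \<in> pverts (Q n)" "v \<in> pverts (Q n)"
  using assms by (cases u, cases v, auto simp: Q_arc_iff Q_verts_iff)+

lemma Q_same_layer_arc:
  assumes "n \<ge> 4" "u \<in> pverts (Q n)" "v \<in> pverts (Q n)" "fst u = fst v" "u \<noteq> v"
  shows "(u, v) \<in> parcs (Q n)"
  using assms by (cases u, cases v) (auto simp: Q_arc_iff Q_verts_iff)

lemma cyclic_succ_inj:
  assumes "(i + 1) mod n = (j + 1) mod n" "i < n" "j < (n :: nat)"
  shows "i = j"
  using assms by (simp add: mod_Suc split: if_splits)

text \<open>Up to three steps around a cycle of at least four layers never return to the start; this
  keeps cliques from winding around the cycle.\<close>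

lemma cyclic_succ_neq:
  assumes "n \<ge> 4" "i < (n :: nat)"
  shows "(i + 1) mod n \<noteq> i" "((i + 1) mod n + 1) mod n \<noteq> i"
    "(((i + 1) mod n + 1) mod n + 1) mod n \<noteq> i"
  using assms by (auto simp: mod_Suc)

lemma cyclic_pred_exists:
  assumes "i < (n :: nat)"
  obtains j where "j < n" "i = (j + 1) mod n"
proof (cases i)
  case 0
  then show thesis using assms that[of "n - 1"] by simp
next
  case (Suc k)
  then show thesis using assms that[of k] by simp
qed

text \<open>The vertex \<open>(Suc i, x, y)\<close> has the neighbour \<open>(i, 0, x)\<close> one
  layer down, so every vertex descends to layer 0, which is a clique.\<close>

lemma Q_connected:
  assumes n: "n \<ge> 4"
  shows "Digraph_Component.connected (with_proj (Q n))"
proof -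
  interpret pair_graph "Q n"
    using Q_pair_graph n by simp
  let ?D = "with_proj (Q n)"
  have step: "u \<rightarrow>\<^sup>*\<^bsub>?D\<^esub> v" if "(u, v) \<in> parcs (Q n)" for u v
    using that by (intro reachable_adjI) (auto simp: arcs_ends_def arc_to_ends_def)
  have down: "(i, x, y) \<rightarrow>\<^sup>*\<^bsub>?D\<^esub> (0, 0, 0)" if "i < n" "x < 2" "y < 2" for i x y
    using that
  proof (induction i arbitrary: x y)
    case 0
    then show ?case
      using n by (cases "(x, y) = (0, 0)") (auto intro!: step simp: Q_arc_iff Q_verts_iff)
  next
    case (Suc i)
    have "(Suc i, x, y) \<rightarrow>\<^sup>*\<^bsub>?D\<^esub> (i, 0, x)"
      using Suc.prems n by (intro step) (simp add: Q_arc_iff)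
    also have "\<dots> \<rightarrow>\<^sup>*\<^bsub>?D\<^esub> (0, 0, 0)"
      using Suc by simp
    finally show ?case .
  qed
  have "u \<rightarrow>\<^sup>*\<^bsub>?D\<^esub> v" if "u \<in> pverts (Q n)" "v \<in> pverts (Q n)" for u v
  proof -
    have "u \<rightarrow>\<^sup>*\<^bsub>?D\<^esub> (0, 0, 0)" "v \<rightarrow>\<^sup>*\<^bsub>?D\<^esub> (0, 0, 0)"
      using that down by (cases u, cases v, auto simp: Q_verts_iff)+
    then show ?thesis
      by (meson reachable_trans symmetric_reachable sym_arcs)
  qed
  moreover have "pverts (Q n) \<noteq> {}"
    using n by (auto simp: Q_def lessThan_empty_iff)
  ultimately show ?thesis
    unfolding Digraph_Component.connected_def
    by (intro strongly_connectedI) (auto intro!: reachable_mk_symmetricI)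
qed

lemma Q_card_verts: "card (pverts (Q n)) = 4 * n"
  by (simp add: Q_def)

text \<open>On bits \<open>1 - x\<close> is the complement; naming the preceding layer
  \<open>j\<close> avoids subtraction modulo \<open>n\<close>.\<close>

lemma Q_neighbours:
  assumes n: "n \<ge> 4" and x: "i < n" "x < 2" "y < 2" and j: "j < n" "i = (j + 1) mod n"
  shows "{w \<in> pverts (Q n). ((i, x, y), w) \<in> parcs (Q n)} =
    {(i, 1 - x, y), (i, x, 1 - y), (i, 1 - x, 1 - y),
     ((i + 1) mod n, y, 0), ((i + 1) mod n, y, 1), (j, 0, x), (j, 1, x)}"
proof (rule Set.set_eqI)
  fix w :: "nat \<times> nat \<times> nat"
  obtain k u v where w: "w = (k, u, v)"
    by (cases w)
  define s where "s = (i + 1) mod n"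
  have s: "s < n"
    using n by (simp add: s_def)
  have "((i, x, y), w) \<in> parcs (Q n) \<longleftrightarrow> k < n \<and> u < 2 \<and> v < 2 \<and>
      (i = k \<and> (x, y) \<noteq> (u, v) \<or> k = s \<and> u = y \<or> k = j \<and> x = v)"
    using n x j cyclic_succ_inj[of k n j] by (auto simp: w Q_arc_iff s_def)
  moreover have "x = 0 \<or> x = 1" "y = 0 \<or> y = 1"
    using x by auto
  ultimately show "w \<in> {w \<in> pverts (Q n). ((i, x, y), w) \<in> parcs (Q n)} \<longleftrightarrow>
    w \<in> {(i, 1 - x, y), (i, x, 1 - y), (i, 1 - x, 1 - y),
     ((i + 1) mod n, y, 0), ((i + 1) mod n, y, 1), (j, 0, x), (j, 1, x)}"
    unfolding s_def[symmetric] using x(1) j(1) s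
    by (elim disjE) (auto simp: w Q_verts_iff less_2_cases_iff)
qed

lemma Q_has_valency:
  assumes n: "n \<ge> 4"
  shows "has_valency (Q n) 7"
  unfolding has_valency_def
proof
  fix v assume "v \<in> pverts (Q n)"
  then obtain i x y where v: "v = (i, x, y)" and x: "i < n" "x < 2" "y < 2"
    by (cases v) (auto simp: Q_verts_iff)
  obtain j where j: "j < n" "i = (j + 1) mod n"
    using cyclic_pred_exists x by blast
  have "(i + 1) mod n \<noteq> i" "(i + 1) mod n \<noteq> j" "j \<noteq> i"
    using cyclic_succ_neq[OF n j(1)] cyclic_succ_neq[OF n x(1)] j(2) by auto
  moreover have "1 - x \<noteq> x" "1 - y \<noteq> y"
    using x by presburger+
  ultimately show "card {w \<in> pverts (Q n). (v, w) \<in> parcs (Q n)} = 7"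
    unfolding v Q_neighbours[OF n x j] by auto
qed

section \<open>Cliques and stable sets\<close>

lemma Q_layer_is_clique:
  assumes "n \<ge> 4" "i < n"
  shows "is_clique (Q n) ({i} \<times> {..<2} \<times> {..<2})"
  using assms by (auto simp: is_clique_def Q_arc_iff Q_verts_iff)

lemma Q_stable_set_layer_unique:
  assumes "n \<ge> 4" "is_stable_set (Q n) S" "u \<in> S" "v \<in> S" "fst u = fst v"
  shows "u = v"
  using assms Q_same_layer_arc[of n u v] unfolding is_stable_set_def by blast

text \<open>If \<open>S\<close> missed layer \<open>i\<close>, its vertex in the preceding layer
  would block only one first bit there, and its vertex in the next layer only one second bit. The
  vertex \<open>(i, a, b)\<close> avoiding both could be added.\<close>

lemma Q_maximal_stable_set_meets_layer:
  assumes n: "n \<ge> 4" and S: "is_maximal_stable_set (Q n) S" and i: "i < n"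
  shows "\<exists>x y. (i, x, y) \<in> S"
proof (rule ccontr)
  assume none: "\<not> ?thesis"
  have st: "is_stable_set (Q n) S"
    using S by (simp add: is_maximal_stable_set_def)
  obtain j where j: "j < n" "i = (j + 1) mod n"
    using cyclic_pred_exists i by blast
  \<comment> \<open>The complement of the bit by which \<open>S\<close> is attached to layer
    \<open>i\<close> from layer \<open>j\<close>; any bit, here 0, if \<open>S\<close> misses layer
    \<open>j\<close>.\<close>
  obtain a where a: "a < 2" "\<And>x. (j, x, a) \<notin> S"
  proof (cases "\<exists>x y. (j, x, y) \<in> S")
    case True
    then obtain x y where xy: "(j, x, y) \<in> S"
      by blast
    then have "y < 2"
      using st by (auto simp: is_stable_set_def Q_verts_iff)
    moreover have "y' = y" if "(j, x', y') \<in> S" for x' y'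
      using Q_stable_set_layer_unique[OF n st that xy] by simp
    moreover have "y \<noteq> 1 - y"
      using \<open>y < 2\<close> by presburger
    ultimately show ?thesis
      by (intro that[of "1 - y"]) (simp, metis)
  qed (use that[of 0] in auto)
  obtain b where b: "b < 2" "\<And>y. ((i + 1) mod n, b, y) \<notin> S"
  proof (cases "\<exists>x y. ((i + 1) mod n, x, y) \<in> S")
    case True
    then obtain x y where xy: "((i + 1) mod n, x, y) \<in> S"
      by blast
    then have "x < 2"
      using st by (auto simp: is_stable_set_def Q_verts_iff)
    moreover have "x' = x" if "((i + 1) mod n, x', y') \<in> S" for x' y'
      using Q_stable_set_layer_unique[OF n st that xy] by simp
    moreover have "x \<noteq> 1 - x"
      using \<open>x < 2\<close> by presburger
    ultimately show ?thesis
      by (intro that[of "1 - x"]) (simp, metis)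
  qed (use that[of 0] in auto)
  have free: "((i, a, b), w) \<notin> parcs (Q n)" if "w \<in> S" for w
  proof -
    obtain k u v where w: "w = (k, u, v)"
      by (cases w)
    have "k = j" if "i = (k + 1) mod n" "k < n"
      using cyclic_succ_inj that j by blast
    then show ?thesis
      using a(2) b(2) none n \<open>w \<in> S\<close> unfolding w by (auto simp: Q_arc_iff)
  qed
  \<comment> \<open>\<open>is_stable_set\<close> also compares a vertex with itself, so the absence
    of a loop has to be checked.\<close>
  have "((i, a, b), (i, a, b)) \<notin> parcs (Q n)"
    using n i cyclic_succ_neq(1)[OF n i] by (auto simp: Q_arc_iff)
  moreover have "(w, (i, a, b)) \<notin> parcs (Q n)" if "w \<in> S" for w
    using free[OF that] Q_arc_sym by blast
  ultimately have "is_stable_set (Q n) (insert (i, a, b) S)"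
    using st free i a(1) b(1)
    unfolding is_stable_set_def by (auto simp: Q_verts_iff)
  then have "(i, a, b) \<in> S"
    using S unfolding is_maximal_stable_set_def by blast
  then show False
    using none by blast
qed

text \<open>An edge between consecutive layers fixes the bit \<open>y\<close> shared by its ends. No
  third layer is adjacent to both layers, and adjacency to these ends forces \<open>y\<close> on the
  rest of the clique.\<close>

lemma Q_clique_cases:
  assumes n: "n \<ge> 4" and K: "is_clique (Q n) K" "K \<noteq> {}"
  obtains (layer) i where "i < n" "K \<subseteq> {i} \<times> {..<2} \<times> {..<2}"
    | (junction) i y where "i < n" "y < 2"
        "K \<subseteq> {i} \<times> {..<2} \<times> {y} \<union> {(i + 1) mod n} \<times> {y} \<times> {..<2}"
proof (cases "\<exists>i x y z u. (i, x, y) \<in> K \<and> ((i + 1) mod n, z, u) \<in> K")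
  case True
  then obtain i x y z u where K1: "(i, x, y) \<in> K" "((i + 1) mod n, z, u) \<in> K"
    by blast
  have i: "i < n" "y < 2"
    using K K1 by (auto simp: is_clique_def Q_verts_iff)
  note succ = cyclic_succ_neq[OF n i(1)]
  have adj: "(p, q) \<in> parcs (Q n)" if "p \<in> K" "q \<in> K" "p \<noteq> q" for p q
    using K that by (auto simp: is_clique_def)
  have "((i, x, y), ((i + 1) mod n, z, u)) \<in> parcs (Q n)"
    using adj[OF K1] succ by auto
  then have z: "z = y"
    using succ n by (auto simp: Q_arc_iff)
  have "w \<in> {i} \<times> {..<2} \<times> {y} \<union> {(i + 1) mod n} \<times> {y} \<times> {..<2}" if w: "w \<in> K" for w
  proof -
    obtain k a b where w': "w = (k, a, b)"
      by (cases w)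
    have k: "k < n" "a < 2" "b < 2"
      using w w' K by (auto simp: is_clique_def Q_verts_iff)
    have "w = (i, x, y) \<or> (w, (i, x, y)) \<in> parcs (Q n)"
      using adj w K1 by blast
    then have 1: "k = i \<or> i = (k + 1) mod n \<or> k = (i + 1) mod n \<and> a = y"
      using n unfolding w' by (auto simp: Q_arc_iff)
    have "w = ((i + 1) mod n, z, u) \<or> (w, ((i + 1) mod n, z, u)) \<in> parcs (Q n)"
      using adj w K1 by blast
    then have "k = (i + 1) mod n \<or> (i + 1) mod n = (k + 1) mod n \<and> b = y
        \<or> k = ((i + 1) mod n + 1) mod n"
      using n unfolding w' z by (auto simp: Q_arc_iff)
    then have 2: "k = (i + 1) mod n \<or> k = i \<and> b = y \<or> k = ((i + 1) mod n + 1) mod n"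
      using cyclic_succ_inj[of i n k] i(1) k(1) by metis
    have "k = i \<and> b = y \<or> k = (i + 1) mod n \<and> a = y"
      using 1 2 succ by metis
    then show ?thesis
      using k i unfolding w' by auto
  qed
  then show thesis
    by (intro junction[OF i]) (rule subsetI)
next
  case False
  obtain i x y where K1: "(i, x, y) \<in> K"
    using K(2) by auto
  have "w \<in> {i} \<times> {..<2} \<times> {..<2}" if w: "w \<in> K" for w
  proof -
    obtain k a b where w': "w = (k, a, b)"
      by (cases w)
    have "w = (i, x, y) \<or> (w, (i, x, y)) \<in> parcs (Q n)" "w \<in> pverts (Q n)" "(i, x, y) \<in> pverts (Q n)"
      using K K1 w by (auto simp: is_clique_def)
    then show ?thesis
      using False w K1 n unfolding w' by (auto simp: Q_arc_iff Q_verts_iff)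
  qed
  moreover have "i < n"
    using K K1 by (auto simp: is_clique_def Q_verts_iff)
  ultimately show thesis
    by (intro layer[of i]) (assumption, rule subsetI)
qed

lemma Q_junction_is_clique:
  assumes n: "n \<ge> 4" and i: "i < n" "y < 2"
  shows "is_clique (Q n) ({i} \<times> {..<2} \<times> {y} \<union> {(i + 1) mod n} \<times> {y} \<times> {..<2})"
proof -
  define s where "s = (i + 1) mod n"
  have s: "s < n"
    using n by (simp add: s_def)
  have "((i, a, y), (s, y, b)) \<in> parcs (Q n)" "((s, y, b), (i, a, y)) \<in> parcs (Q n)"
    if "a < 2" "b < 2" for a b
    using n i s that by (simp_all add: Q_arc_iff s_def)
  moreover have "((i, a, y), (i, b, y)) \<in> parcs (Q n) \<longleftrightarrow> a \<noteq> b"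
      "((s, y, a), (s, y, b)) \<in> parcs (Q n) \<longleftrightarrow> a \<noteq> b"
    if "a < 2" "b < 2" for a b
    using n i s that cyclic_succ_neq(1)[OF n i(1)] cyclic_succ_neq(1)[OF n s] by (auto simp: Q_arc_iff)
  ultimately show ?thesis
    unfolding s_def[symmetric] is_clique_def using i s by (auto simp: Q_verts_iff)
qed

text \<open>Maximality turns the inclusions of \<open>Q_clique_cases\<close> into equalities,
  leaving full layers and full junctions to be met.\<close>

lemma Q_is_CIS:
  assumes n: "n \<ge> 4"
  shows "is_CIS (Q n)"
  unfolding is_CIS_def
proof (intro allI impI, elim conjE)
  fix S K assume S: "is_maximal_stable_set (Q n) S" and K: "is_maximal_clique (Q n) K"
  note meets = Q_maximal_stable_set_meets_layer[OF n S]
  have st: "is_stable_set (Q n) S"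
    using S by (simp add: is_maximal_stable_set_def)
  have bnd: "i < n \<and> x < 2 \<and> y < 2" if "(i, x, y) \<in> S" for i x y
    using st that by (auto simp: is_stable_set_def Q_verts_iff)
  have clq: "is_clique (Q n) K" and max: "\<And>K'. is_clique (Q n) K' \<Longrightarrow> K \<subseteq> K' \<Longrightarrow> K = K'"
    using K unfolding is_maximal_clique_def by blast+
  have "K \<noteq> {}"
  proof
    assume "K = {}"
    then have "K = {0} \<times> {..<2} \<times> {..<2}"
      using n by (intro max[OF Q_layer_is_clique[OF n]]) simp_all
    with \<open>K = {}\<close> show False
      by (auto dest: equalityD2 simp: lessThan_empty_iff)
  qed
  with n clq show "S \<inter> K \<noteq> {}"
  proof (cases rule: Q_clique_cases)
    case (layer i)
    then have "K = {i} \<times> {..<2} \<times> {..<2}"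
      using max Q_layer_is_clique[OF n] by blast
    then show ?thesis
      using meets[OF layer(1)] bnd by fastforce
  next
    case (junction i y)
    then have K_eq: "K = {i} \<times> {..<2} \<times> {y} \<union> {(i + 1) mod n} \<times> {y} \<times> {..<2}"
      using max Q_junction_is_clique[OF n] by blast
    have i': "(i + 1) mod n < n"
      using n by simp
    obtain a b where ab: "(i, a, b) \<in> S"
      using meets[OF junction(1)] by blast
    obtain c d where cd: "((i + 1) mod n, c, d) \<in> S"
      using meets[OF i'] by blast
    have "((i, a, b), ((i + 1) mod n, c, d)) \<notin> parcs (Q n)"
      using st ab cd by (auto simp: is_stable_set_def)
    then have "b \<noteq> c"
      using bnd[OF ab] bnd[OF cd] n by (auto simp: Q_arc_iff)
    then have "b = y \<or> c = y"
      using bnd[OF ab] bnd[OF cd] junction(2) by auto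
    then show ?thesis
      using ab cd bnd[OF ab] bnd[OF cd] unfolding K_eq by auto
  qed
qed

lemma Q_stability_number:
  assumes n: "n \<ge> 4"
  shows "stability_number (Q n) = n"
  unfolding stability_number_def
proof (rule Max_eqI)
  have fin: "finite (pverts (Q n))"
    by (simp add: Q_def)
  then have "finite {S. is_stable_set (Q n) S}"
    by (rule finite_subset[rotated, OF finite_Pow_iff[THEN iffD2]]) (auto simp: is_stable_set_def)
  then show "finite (card ` {S. is_stable_set (Q n) S})"
    by simp
next
  fix k assume "k \<in> card ` {S. is_stable_set (Q n) S}"
  then obtain S where S: "is_stable_set (Q n) S" "k = card S"
    by blast
  have "inj_on fst S"
    using Q_stable_set_layer_unique[OF n S(1)] by (auto intro!: inj_onI)
  moreover have "fst ` S \<subseteq> {..<n}"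
    using S by (auto simp: is_stable_set_def Q_def)
  ultimately have "card S \<le> card {..<n}"
    by (rule card_inj_on_le) simp
  then show "k \<le> n"
    using S by simp
next
  \<comment> \<open>The second bit 1 never matches the first bit 0 of the next layer.\<close>
  have "is_stable_set (Q n) ({..<n} \<times> {0} \<times> {1})"
    using n by (auto simp: is_stable_set_def Q_arc_iff Q_verts_iff)
  then show "n \<in> card ` {S. is_stable_set (Q n) S}"
    by (auto simp: image_iff intro!: exI[of _ "{..<n} \<times> {0} \<times> {1}"])
qed

lemma Q_clique_number:
  assumes n: "n \<ge> 4"
  shows "clique_number (Q n) = 4"
  unfolding clique_number_def
proof (rule Max_eqI)
  have fin: "finite (pverts (Q n))"
    by (simp add: Q_def)
  then have "finite {K. is_clique (Q n) K}"
    by (rule finite_subset[rotated, OF finite_Pow_iff[THEN iffD2]]) (auto simp: is_clique_def)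
  then show "finite (card ` {K. is_clique (Q n) K})"
    by simp
next
  fix k assume "k \<in> card ` {K. is_clique (Q n) K}"
  then obtain K where K: "is_clique (Q n) K" "k = card K"
    by blast
  show "k \<le> 4"
  proof (cases "K = {}")
    case False
    with n K(1) show ?thesis
    proof (cases rule: Q_clique_cases)
      case (layer i)
      then have "card K \<le> card ({i} \<times> {..<2 :: nat} \<times> {..<2 :: nat})"
        by (intro card_mono) auto
      then show ?thesis
        using K by simp
    next
      case (junction i y)
      then have "card K \<le> card ({i} \<times> {..<2} \<times> {y} \<union> {(i + 1) mod n} \<times> {y} \<times> {..<2})"
        by (intro card_mono) auto
      also have "\<dots> \<le> card ({i} \<times> {..<2 :: nat} \<times> {y}) + card ({(i + 1) mod n} \<times> {y} \<times> {..<2 :: nat})"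
        by (rule card_Un_le)
      finally show ?thesis
        using K by simp
    qed
  qed (use K in simp)
next
  have "is_clique (Q n) ({0} \<times> {..<2} \<times> {..<2})"
    using Q_layer_is_clique n by simp
  then show "4 \<in> card ` {K. is_clique (Q n) K}"
    by (intro image_eqI[where x = "{0} \<times> {..<2} \<times> {..<2}"]) simp_all
qed

section \<open>Vertex-transitivity\<close>

text \<open>The library's isomorphisms also carry an arc map and new end functions. Taking
  \<open>map_prod h h\<close> on arcs and keeping the projections leaves conditions on
  \<open>h\<close> alone.\<close>

lemma is_vertex_transitiveI:
  assumes wf: "wf_digraph (with_proj \<Gamma>)"
    and ex: "\<And>u v. u \<in> pverts \<Gamma> \<Longrightarrow> v \<in> pverts \<Gamma> \<Longrightarrow>
      \<exists>h. bij_betw h (pverts \<Gamma>) (pverts \<Gamma>) \<and> map_prod h h ` parcs \<Gamma> = parcs \<Gamma> \<and> h u = v"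
  shows "is_vertex_transitive \<Gamma>"
  unfolding is_vertex_transitive_def
proof (intro ballI)
  fix u v assume uv: "u \<in> pverts \<Gamma>" "v \<in> pverts \<Gamma>"
  obtain h where h: "bij_betw h (pverts \<Gamma>) (pverts \<Gamma>)" "map_prod h h ` parcs \<Gamma> = parcs \<Gamma>" "h u = v"
    using ex[OF uv] by blast
  let ?f = "\<lparr>iso_verts = h, iso_arcs = map_prod h h, iso_head = snd, iso_tail = fst\<rparr>"
  have "parcs \<Gamma> \<subseteq> pverts \<Gamma> \<times> pverts \<Gamma>"
    using wf_digraph.tail_in_verts[OF wf] wf_digraph.head_in_verts[OF wf] by force
  moreover have "inj_on (map_prod h h) (pverts \<Gamma> \<times> pverts \<Gamma>)"
    using h(1) by (intro map_prod_inj_on) (auto simp: bij_betw_def)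
  ultimately have "inj_on (map_prod h h) (parcs \<Gamma>)"
    using inj_on_subset by blast
  then have "pre_digraph.digraph_isomorphism (with_proj \<Gamma>) ?f"
    using wf h(1) by (auto simp: pre_digraph.digraph_isomorphism_def bij_betw_def)
  moreover have "app_iso ?f (with_proj \<Gamma>) = with_proj \<Gamma>"
    using h by (simp add: app_iso_def with_proj_def bij_betw_def)
  ultimately show "\<exists>f. pre_digraph.digraph_isomorphism (with_proj \<Gamma>) f
      \<and> app_iso f (with_proj \<Gamma>) = with_proj \<Gamma> \<and> iso_verts f u = v"
    using h(3) by (intro exI[of _ ?f]) simp
qed

lemma add_mod_eq_iff:
  assumes "a < m" "b < (m :: nat)"
  shows "(a + c) mod m = (b + c) mod m \<longleftrightarrow> a = b"
  using assms
proof (induction a b rule: linorder_wlog)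
  case (le a b)
  show ?case
  proof
    assume "(a + c) mod m = (b + c) mod m"
    then have "m dvd b - a"
      using le mod_eq_dvd_iff_nat[of "a + c" "b + c" m] by simp
    then show "a = b"
      using le nat_dvd_not_less[of "b - a" m] by fastforce
  qed simp
qed metis

text \<open>In \<open>(k, a, b)\<close> the bit \<open>a\<close> faces the preceding layer and
  \<open>b\<close> the next one. Rotations preserve adjacency, and so does complementing all bits
  that face each other across one gap; \<open>h\<close> combines both.\<close>

lemma Q_is_vertex_transitive:
  assumes n: "n \<ge> 4"
  shows "is_vertex_transitive (Q n)"
proof (rule is_vertex_transitiveI)
  interpret pair_graph "Q n"
    using Q_pair_graph n by simp
  show "wf_digraph (with_proj (Q n))"
    by unfold_locales
  fix p q assume p: "p \<in> pverts (Q n)" and q: "q \<in> pverts (Q n)"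
  obtain i x y where p': "p = (i, x, y)" "i < n" "x < 2" "y < 2"
    using p by (cases p) (auto simp: Q_verts_iff)
  obtain j u v where q': "q = (j, u, v)" "j < n" "u < 2" "v < 2"
    using q by (cases q) (auto simp: Q_verts_iff)
  \<comment> \<open>Rotation by \<open>j - i\<close>, with \<open>n\<close> added to avoid truncated
    subtraction.\<close>
  define c where "c = j + n - i"
  \<comment> \<open>\<open>F k\<close> is added to the bits on both sides of the gap before layer
    \<open>k\<close>. Its values around layer \<open>j\<close> turn \<open>x\<close> and
    \<open>y\<close> into \<open>u\<close> and \<open>v\<close> modulo 2.\<close>
  define F where "F k = (if k = j then u + x else if k = (j + 1) mod n then v + y else 0)" for k
  define h where "h = (\<lambda>(k, a, b).
    ((k + c) mod n, (a + F ((k + c) mod n)) mod 2, (b + F ((k + c + 1) mod n)) mod 2))"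
  have inj: "inj_on h (pverts (Q n))"
  proof (rule inj_onI)
    fix s t assume "s \<in> pverts (Q n)" "t \<in> pverts (Q n)" and eq: "h s = h t"
    then obtain k a b l d e where s: "s = (k, a, b)" "t = (l, d, e)"
        and bd: "k < n" "l < n" "a < 2" "b < 2" "d < 2" "e < 2"
      by (cases s, cases t) (auto simp: Q_verts_iff)
    have "k = l"
      using eq bd unfolding s by (simp add: h_def add_mod_eq_iff)
    moreover have "a = d" "b = e"
      using eq bd \<open>k = l\<close> unfolding s by (simp_all add: h_def add_mod_eq_iff)
    ultimately show "s = t"
      by (simp add: s)
  qed
  have sub: "h ` pverts (Q n) \<subseteq> pverts (Q n)"
    using n by (auto simp: h_def Q_def)
  have "finite (pverts (Q n))"
    by (simp add: Q_def)
  with inj sub have bij: "bij_betw h (pverts (Q n)) (pverts (Q n))"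
    unfolding bij_betw_def using endo_inj_surj by blast
  \<comment> \<open>The bits facing each other across a gap receive the same summand.\<close>
  have step: "(h (k, a, b), h ((k + 1) mod n, b, d)) \<in> parcs (Q n)"
    if "k < n" "a < 2" "b < 2" "d < 2" for k a b d
  proof -
    have "((k + 1) mod n + c) mod n = ((k + c) mod n + 1) mod n"
         "((k + 1) mod n + c) mod n = (k + c + 1) mod n"
      by (simp_all add: mod_simps)
    then show ?thesis
      using n by (simp add: h_def Q_arc_iff)
  qed
  have "(h s, h t) \<in> parcs (Q n)" if st: "(s, t) \<in> parcs (Q n)" for s t
  proof -
    obtain k a b l d e where s: "s = (k, a, b)" "t = (l, d, e)"
      by (cases s, cases t)
    have bd: "k < n" "l < n" "a < 2" "b < 2" "d < 2" "e < 2"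
      using st n unfolding s by (simp_all add: Q_arc_iff)
    consider "k = l" "(a, b) \<noteq> (d, e)" | "l = (k + 1) mod n" "d = b" | "k = (l + 1) mod n" "a = e"
      using st n unfolding s by (auto simp: Q_arc_iff)
    then show ?thesis
    proof cases
      case 1
      have V: "s \<in> pverts (Q n)" "t \<in> pverts (Q n)"
        using bd by (simp_all add: s Q_verts_iff)
      have "s \<noteq> t" "fst (h s) = fst (h t)"
        using 1 by (auto simp: s h_def)
      moreover have "h s \<noteq> h t"
        using inj_onD[OF inj _ V] \<open>s \<noteq> t\<close> by blast
      ultimately show ?thesis
        using n V sub by (intro Q_same_layer_arc) auto
    next
      case 2
      then show ?thesis
        using step[of k a b e] bd unfolding s by simp
    next
      case 3
      then show ?thesis
        using step[of l d e b, THEN Q_arc_sym] bd unfolding s by simp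
    qed
  qed
  then have "map_prod h h ` parcs (Q n) \<subseteq> parcs (Q n)"
    by auto
  \<comment> \<open>An injective map of the finite arc set into itself is onto, so preserving arcs
    in one direction suffices.\<close>
  moreover have "inj_on (map_prod h h) (parcs (Q n))"
  proof (rule inj_on_subset)
    show "inj_on (map_prod h h) (pverts (Q n) \<times> pverts (Q n))"
      by (rule map_prod_inj_on[OF inj inj])
    show "parcs (Q n) \<subseteq> pverts (Q n) \<times> pverts (Q n)"
      using Q_arc_verts[of n] n by (intro subrelI SigmaI) simp_all
  qed
  moreover have "finite (parcs (Q n))"
    by simp
  ultimately have "map_prod h h ` parcs (Q n) = parcs (Q n)"
    by (intro endo_inj_surj)
  moreover have "h p = q"
  proof -
    have "i + c = j + n"
      using p'(2) by (simp add: c_def)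
    then have "(i + c) mod n = j" "(i + c + 1) mod n = (j + 1) mod n"
      using q'(2) by (simp_all add: mod_Suc)
    moreover have "(j + 1) mod n \<noteq> j"
      using cyclic_succ_neq(1)[OF n q'(2)] .
    moreover have "(x + (u + x)) mod 2 = u" "(y + (v + y)) mod 2 = v"
      using p' q' by presburger+
    ultimately show ?thesis
      by (simp add: h_def p'(1) q'(1) F_def)
  qed
  ultimately show "\<exists>h. bij_betw h (pverts (Q n)) (pverts (Q n))
      \<and> map_prod h h ` parcs (Q n) = parcs (Q n) \<and> h p = q"
    using bij by blast
qed

section \<open>Automorphisms preserve the layers\<close>

text \<open>
  An edge inside a layer whose ends share a coordinate lies in an induced diamond, and no edge
  between two layers does. This makes the layers recognisable from the graph alone.
\<close>

lemma Q_diamond_same_layer: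
  assumes n: "n \<ge> 4"
    and uv: "(u, v) \<in> parcs (Q n)"
    and w: "(u, w) \<in> parcs (Q n)" "(v, w) \<in> parcs (Q n)"
    and w': "(u, w') \<in> parcs (Q n)" "(v, w') \<in> parcs (Q n)"
    and ww': "w \<noteq> w'" "(w, w') \<notin> parcs (Q n)"
  shows "fst u = fst v"
proof (rule ccontr)
  assume ne: "fst u \<noteq> fst v"
  \<comment> \<open>A triangle on an edge between two layers lies in a junction
    \<open>J k y\<close>, and the edge determines this junction; so \<open>w\<close> and
    \<open>w'\<close> would lie in one clique.\<close>
  define J where "J k y = {k} \<times> {..<2} \<times> {y} \<union> {(k + 1) mod n} \<times> {y} \<times> {..<2}" for k y :: nat
  have ex: "\<exists>k y. k < n \<and> y < 2 \<and> u \<in> J k y \<and> v \<in> J k y \<and> t \<in> J k y"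
    if "(u, t) \<in> parcs (Q n)" "(v, t) \<in> parcs (Q n)" for t
  proof -
    have "is_clique (Q n) {u, v, t}" "{u, v, t} \<noteq> {}"
      using uv that Q_arc_sym Q_arc_verts[of n] n unfolding is_clique_def by auto
    with n show ?thesis
    proof (cases rule: Q_clique_cases)
      case (layer i)
      then show ?thesis using ne by auto
    next
      case (junction k y)
      then show ?thesis unfolding J_def by blast
    qed
  qed
  obtain k y where k: "k < n" "y < 2" "u \<in> J k y" "v \<in> J k y" "w \<in> J k y"
    using ex[OF w] by blast
  obtain l z where l: "l < n" "z < 2" "u \<in> J l z" "v \<in> J l z" "w' \<in> J l z"
    using ex[OF w'] by blast
  have lay: "{fst u, fst v} = {k', (k' + 1) mod n}" if "u \<in> J k' y'" "v \<in> J k' y'" for k' y'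
    using that ne unfolding J_def by auto
  have "{k, (k + 1) mod n} = {l, (l + 1) mod n}"
    using lay[OF k(3,4)] lay[OF l(3,4)] by simp
  then have kl: "k = l"
    using cyclic_succ_neq(2)[OF n k(1)] by (metis doubleton_eq_iff)
  moreover have "y = z"
    using k(3,4) l(3,4) ne cyclic_succ_neq(1)[OF n k(1)] unfolding J_def kl by auto
  ultimately have "w' \<in> J k y"
    using l by simp
  moreover have "is_clique (Q n) (J k y)"
    unfolding J_def by (rule Q_junction_is_clique[OF n k(1,2)])
  ultimately show False
    using k(5) ww' unfolding is_clique_def by blast
qed

text \<open>Two vertices of a layer differing in one bit span the middle edge of a diamond, and
  \<open>h\<close> carries diamonds to diamonds. A pair differing in both bits is linked through
  \<open>(i, x', y)\<close>.\<close>

lemma Q_same_layer_preserved: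
  assumes n: "n \<ge> 4"
    and h: "inj_on h (pverts (Q n))"
    and arc: "\<And>u v. u \<in> pverts (Q n) \<Longrightarrow> v \<in> pverts (Q n) \<Longrightarrow>
      (h u, h v) \<in> parcs (Q n) \<longleftrightarrow> (u, v) \<in> parcs (Q n)"
    and u: "u \<in> pverts (Q n)" and v: "v \<in> pverts (Q n)" and uv: "fst u = fst v"
  shows "fst (h u) = fst (h v)"
proof -
  have diamond: "fst (h a) = fst (h b)"
    if "(a, b) \<in> parcs (Q n)" "(a, c) \<in> parcs (Q n)" "(b, c) \<in> parcs (Q n)"
      "(a, d) \<in> parcs (Q n)" "(b, d) \<in> parcs (Q n)" "c \<noteq> d" "(c, d) \<notin> parcs (Q n)" for a b c d
  proof (rule Q_diamond_same_layer[OF n])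
    have V: "a \<in> pverts (Q n)" "b \<in> pverts (Q n)" "c \<in> pverts (Q n)" "d \<in> pverts (Q n)"
      using that(1,2,4) Q_arc_verts[of n] n by auto
    show "(h a, h b) \<in> parcs (Q n)" "(h a, h c) \<in> parcs (Q n)" "(h b, h c) \<in> parcs (Q n)"
      "(h a, h d) \<in> parcs (Q n)" "(h b, h d) \<in> parcs (Q n)" "(h c, h d) \<notin> parcs (Q n)"
      using that V arc by simp_all
    show "h c \<noteq> h d"
      using that(6) V h by (meson inj_onD)
  qed
  obtain i x y x' y' where uv': "u = (i, x, y)" "v = (i, x', y')"
    using uv by (cases u, cases v) auto
  have bd: "i < n" "x < 2" "y < 2" "x' < 2" "y' < 2"
    using u v unfolding uv' by (simp_all add: Q_verts_iff)
  obtain j where j: "j < n" "i = (j + 1) mod n"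
    using cyclic_pred_exists bd by blast
  define s where "s = (i + 1) mod n"
  then have s_eq: "(i + 1) mod n = s"
    by simp
  have s: "s < n" "s \<noteq> i" "j \<noteq> i" "i \<noteq> (s + 1) mod n" "j \<noteq> (i + 1) mod n"
    using n cyclic_succ_neq[OF n bd(1)] cyclic_succ_neq[OF n j(1)] j(2) by (auto simp: s_def)
  have "fst (h (i, x, y)) = fst (h (i, x', y))"
  proof (cases "x = x'")
    case False
    \<comment> \<open>The bit \<open>1 - y\<close> makes the vertex of layer \<open>i\<close>
      non-adjacent to the common neighbour \<open>(s, y, 0)\<close> in the next layer.\<close>
    show ?thesis
      by (rule diamond[of _ _ "(i, 0, 1 - y)" "(s, y, 0)"])
        (use n bd s s_eq False in \<open>auto simp: Q_arc_iff less_2_cases_iff\<close>)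
  qed simp
  also have "\<dots> = fst (h (i, x', y'))"
  proof (cases "y = y'")
    case False
    \<comment> \<open>The mirror image, with a common neighbour in the preceding layer
      \<open>j\<close>.\<close>
    show ?thesis
      by (rule diamond[of _ _ "(i, 1 - x', 0)" "(j, 0, x')"])
        (use n bd s j(1) j(2)[symmetric] False in \<open>auto simp: Q_arc_iff less_2_cases_iff\<close>)
  qed simp
  finally show ?thesis
    unfolding uv' .
qed

section \<open>Subgroups of large prime order\<close>

lemma (in group) subgroup_of_prime_subgroup:
  assumes H: "subgroup H G" and K: "subgroup K G" and "H \<subseteq> K" and p: "prime (card K)"
  shows "H = {\<one>} \<or> H = K"
proof -
  interpret K: group "G\<lparr>carrier := K\<rparr>"
    using K by (rule subgroup.subgroup_is_group) (rule is_group)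
  have "subgroup H (G\<lparr>carrier := K\<rparr>)"
    using assms by (simp add: subgroup_incl)
  from K.lagrange[OF this] have "card H dvd card K"
    by (simp add: order_def) (metis dvd_triv_right)
  then have "card H = 1 \<or> card H = card K"
    using p by (simp add: prime_nat_iff)
  moreover have "finite K"
    using p by (metis card.infinite not_prime_0)
  moreover have "\<one> \<in> H"
    using H by (rule subgroup.one_closed)
  ultimately show ?thesis
    using \<open>H \<subseteq> K\<close> by (metis card_1_singletonE card_subset_eq singletonD)
qed

text \<open>Distinct subgroups of prime order \<open>p\<close> meet trivially, so
  \<open>a \<otimes> b\<close> takes \<open>p * p\<close> different values on
  \<open>H \<times> K\<close>.\<close>

lemma (in group) prime_subgroups_eq:
  assumes H: "subgroup H G" "card H = p" and K: "subgroup K G" "card K = p"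
    and p: "prime p" and fin: "finite (carrier G)" and small: "order G < p * p"
  shows "H = K"
proof -
  have HK: "subgroup (H \<inter> K) G"
    using H K by (simp add: subgroups_Inter_pair)
  have Hc: "H \<subseteq> carrier G" and Kc: "K \<subseteq> carrier G"
    using H K subgroup.subset by blast+
  consider "H \<inter> K = {\<one>}" | "H \<inter> K = H"
    using subgroup_of_prime_subgroup[OF HK H(1)] H p by auto
  then show ?thesis
  proof cases
    case 1
    have "inj_on (\<lambda>(a, b). a \<otimes> b) (H \<times> K)"
    proof (rule inj_onI, clarify)
      fix a b c d assume ab: "a \<in> H" "b \<in> K" "c \<in> H" "d \<in> K" and eq: "a \<otimes> b = c \<otimes> d"
      have G: "a \<in> carrier G" "b \<in> carrier G" "c \<in> carrier G" "d \<in> carrier G"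
        using ab Hc Kc by auto
      have "inv c \<otimes> a = d \<otimes> inv b"
      proof -
        have "inv c \<otimes> a = inv c \<otimes> (a \<otimes> b) \<otimes> inv b"
          using G by (simp add: m_assoc)
        also have "\<dots> = d \<otimes> inv b"
          unfolding eq using G by (simp flip: m_assoc)
        finally show ?thesis .
      qed
      moreover have "inv c \<otimes> a \<in> H" "d \<otimes> inv b \<in> K"
        using ab H K by (simp_all add: subgroup.m_closed subgroup.m_inv_closed)
      ultimately have "inv c \<otimes> a = \<one>" "d \<otimes> inv b = \<one>"
        using 1 by auto
      then show "a = c \<and> b = d"
        using G by (metis inv_closed inv_equality inv_inv)
    qed
    moreover have "(\<lambda>(a, b). a \<otimes> b) ` (H \<times> K) \<subseteq> carrier G"
      using Hc Kc by auto
    ultimately have "card (H \<times> K) \<le> card (carrier G)"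
      using fin by (rule card_inj_on_le)
    then show ?thesis
      using small H K by (simp add: card_cartesian_product order_def)
  next
    case 2
    then show ?thesis
      using H K fin Kc by (metis Int_lower2 card_subset_eq finite_subset)
  qed
qed

text \<open>A conjugate of \<open>P\<close> is a subgroup of the same order and hence equals
  \<open>P\<close>.\<close>

lemma (in group) prime_subgroup_conj_closed:
  assumes P: "subgroup P G" and p: "prime (card P)" and fin: "finite (carrier G)"
    and small: "order G < card P * card P" and g: "g \<in> carrier G" and x: "x \<in> P"
  shows "g \<otimes> x \<otimes> inv g \<in> P"
proof -
  let ?c = "\<lambda>x. g \<otimes> x \<otimes> inv g"
  have Pc: "P \<subseteq> carrier G"
    using P subgroup.subset by blast
  have "subgroup (?c ` P) G"
  proof (rule subgroupI)
    show "?c ` P \<subseteq> carrier G"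
      using Pc g by auto
    show "?c ` P \<noteq> {}"
      using P subgroup.one_closed by blast
  next
    fix a assume "a \<in> ?c ` P"
    then obtain b where b: "b \<in> P" "a = ?c b" by blast
    then have "inv a = ?c (inv b)"
      using Pc g by (auto simp: inv_mult_group m_assoc)
    then show "inv a \<in> ?c ` P"
      using b P by (simp add: subgroup.m_inv_closed)
  next
    fix a a' assume "a \<in> ?c ` P" "a' \<in> ?c ` P"
    then obtain b b' where b: "b \<in> P" "a = ?c b" "b' \<in> P" "a' = ?c b'" by blast
    have G: "b \<in> carrier G" "b' \<in> carrier G"
      using b Pc by auto
    have "a \<otimes> a' = g \<otimes> b \<otimes> (inv g \<otimes> g) \<otimes> b' \<otimes> inv g"
      unfolding b(2,4) using G g by (simp only: m_assoc m_closed inv_closed)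
    also have "\<dots> = ?c (b \<otimes> b')"
      using G g by (simp add: m_assoc)
    finally show "a \<otimes> a' \<in> ?c ` P"
      using b P by (simp add: subgroup.m_closed)
  qed
  moreover have "inj_on ?c P"
    using Pc g by (auto intro!: inj_onI simp: subset_eq)
  then have "card (?c ` P) = card P"
    by (rule card_image)
  ultimately have "?c ` P = P"
    using prime_subgroups_eq[of "?c ` P" "card P" P] assms by simp
  then show ?thesis
    using x by blast
qed

section \<open>Cayley graphs\<close>

text \<open>Both digraphs have the projections as end functions, which forces the arc map of an
  isomorphism to be \<open>map_prod \<phi> \<phi>\<close>.\<close>

lemma digraph_iso_with_projD:
  assumes "digraph_iso (with_proj \<Gamma>) (with_proj \<Delta>)"
  shows "\<exists>\<phi>. bij_betw \<phi> (pverts \<Gamma>) (pverts \<Delta>) \<and>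
    (\<forall>u\<in>pverts \<Gamma>. \<forall>v\<in>pverts \<Gamma>. (\<phi> u, \<phi> v) \<in> parcs \<Delta> \<longleftrightarrow> (u, v) \<in> parcs \<Gamma>)"
proof -
  obtain f where f: "pre_digraph.digraph_isomorphism (with_proj \<Gamma>) f"
      and eq: "with_proj \<Delta> = app_iso f (with_proj \<Gamma>)"
    using assms unfolding digraph_iso_def by blast
  let ?\<phi> = "iso_verts f"
  have inj: "inj_on ?\<phi> (pverts \<Gamma>)" and wf: "wf_digraph (with_proj \<Gamma>)"
    using f by (simp_all add: pre_digraph.digraph_isomorphism_def)
  have "pverts \<Delta> = ?\<phi> ` pverts \<Gamma>"
    using arg_cong[OF eq, of verts] by simp
  then have "bij_betw ?\<phi> (pverts \<Gamma>) (pverts \<Delta>)"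
    using inj by (simp add: bij_betw_def)
  moreover have "iso_arcs f a = map_prod ?\<phi> ?\<phi> a" if "a \<in> parcs \<Gamma>" for a
  proof -
    have "iso_tail f = fst" "iso_head f = snd"
      using arg_cong[OF eq, of tail] arg_cong[OF eq, of head] by simp_all
    then show ?thesis
      using f that by (auto simp: pre_digraph.digraph_isomorphism_def prod_eq_iff)
  qed
  then have arcs: "parcs \<Delta> = map_prod ?\<phi> ?\<phi> ` parcs \<Gamma>"
    using arg_cong[OF eq, of arcs] by simp
  have "(?\<phi> u, ?\<phi> v) \<in> parcs \<Delta> \<longleftrightarrow> (u, v) \<in> parcs \<Gamma>"
    if "u \<in> pverts \<Gamma>" "v \<in> pverts \<Gamma>" for u v
  proof
    assume "(?\<phi> u, ?\<phi> v) \<in> parcs \<Delta>"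
    then obtain u' v' where *: "(u', v') \<in> parcs \<Gamma>" "?\<phi> u = ?\<phi> u'" "?\<phi> v = ?\<phi> v'"
      unfolding arcs by auto
    moreover have "u' \<in> pverts \<Gamma>" "v' \<in> pverts \<Gamma>"
      using wf_digraph.tail_in_verts[OF wf, of "(u', v')"]
        wf_digraph.head_in_verts[OF wf, of "(u', v')"] *(1) by simp_all
    ultimately show "(u, v) \<in> parcs \<Gamma>"
      using inj that by (metis inj_onD)
  qed (force simp: arcs)
  ultimately show ?thesis
    by blast
qed

text \<open>Labelling the vertices by \<open>\<psi>\<close> turns left multiplication by
  \<open>k\<close> into an automorphism, so the hypotheses describe a regular action of
  \<open>G\<close> on the vertices.\<close>

lemma Q_no_regular_action:
  fixes G (structure) and n :: nat
  assumes "group G" and p: "prime n" and n: "n \<ge> 4"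
    and bij: "bij_betw \<psi> (carrier G) (pverts (Q n))"
    and arc: "\<And>g h k. g \<in> carrier G \<Longrightarrow> h \<in> carrier G \<Longrightarrow> k \<in> carrier G \<Longrightarrow>
      (\<psi> (k \<otimes> g), \<psi> (k \<otimes> h)) \<in> parcs (Q n) \<longleftrightarrow> (\<psi> g, \<psi> h) \<in> parcs (Q n)"
  shows False
proof -
  interpret group G by fact

  \<comment> \<open>The normal Sylow subgroup and the induced action on layers\<close>
  define L where "L g = fst (\<psi> g)" for g
  \<comment> \<open>Excluding 4 gives \<open>4 * n < n * n\<close> for the Sylow argument and makes
    \<open>P\<close> larger than a layer.\<close>
  have n5: "n > 4"
  proof -
    have "\<not> prime (4 :: nat)"
      using primes_dvd_imp_eq[of 2 "4 :: nat"] two_is_prime_nat by auto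
    then show ?thesis
      using n p by (cases "n = 4") auto
  qed
  have \<psi>V: "\<psi> g \<in> pverts (Q n)" if "g \<in> carrier G" for g
    using bij that by (auto simp: bij_betw_def)
  have \<psi>_inj: "g = h" if "\<psi> g = \<psi> h" "g \<in> carrier G" "h \<in> carrier G" for g h
    using bij that by (auto simp: bij_betw_def dest: inj_onD)
  have \<psi>_surj: "\<exists>g\<in>carrier G. \<psi> g = (i, x, y)" if "i < n" "x < 2" "y < 2" for i x y
  proof -
    have "(i, x, y) \<in> \<psi> ` carrier G"
      using bij that by (simp add: bij_betw_def Q_verts_iff)
    then show ?thesis by force
  qed
  have ord: "order G = 4 * n"
    using bij_betw_same_card[OF bij] by (simp add: order_def Q_card_verts)
  then have fin: "finite (carrier G)"
    using n by (simp add: order_def card_ge_0_finite)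
  obtain P where P: "subgroup P G" "card P = n"
    using sylow_thm[OF p is_group, of 1 4] ord fin by (auto simp: mult.commute)
  have Pc: "q \<in> carrier G" if "q \<in> P" for q
    using P(1) that by (rule subgroup.mem_carrier)
  have conj: "g \<otimes> q \<otimes> inv g \<in> P" if "g \<in> carrier G" "q \<in> P" for g q
    using prime_subgroup_conj_closed[OF P(1) _ fin _ that] P(2) p ord n5 by simp
  have L_lt: "L g < n" if "g \<in> carrier G" for g
    using \<psi>V[OF that] unfolding L_def by (cases "\<psi> g") (simp add: Q_verts_iff)
  have L_mult: "L (k \<otimes> g) = L (k \<otimes> h)"
    if "L g = L h" "g \<in> carrier G" "h \<in> carrier G" "k \<in> carrier G" for g h k
  proof -
    \<comment> \<open>Transported to the vertices through \<open>\<psi>\<close> and its inverse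
      \<open>\<phi>\<close>, multiplication by \<open>k\<close> is an automorphism and so respects
      layers.\<close>
    define \<phi> where "\<phi> = inv_into (carrier G) \<psi>"
    have \<phi>: "\<phi> u \<in> carrier G" "\<psi> (\<phi> u) = u" if "u \<in> pverts (Q n)" for u
      using bij that unfolding \<phi>_def by (auto simp: bij_betw_def inv_into_into f_inv_into_f)
    have \<phi>\<psi>: "\<phi> (\<psi> g) = g" if "g \<in> carrier G" for g
      using bij that unfolding \<phi>_def by (simp add: bij_betw_def)
    have "fst (\<psi> (k \<otimes> \<phi> (\<psi> g))) = fst (\<psi> (k \<otimes> \<phi> (\<psi> h)))"
    proof (rule Q_same_layer_preserved[OF n, where h = "\<lambda>u. \<psi> (k \<otimes> \<phi> u)"])
      show "inj_on (\<lambda>u. \<psi> (k \<otimes> \<phi> u)) (pverts (Q n))"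
      proof (rule inj_onI)
        fix u v assume uv: "u \<in> pverts (Q n)" "v \<in> pverts (Q n)"
          and "\<psi> (k \<otimes> \<phi> u) = \<psi> (k \<otimes> \<phi> v)"
        then have "k \<otimes> \<phi> u = k \<otimes> \<phi> v"
          using \<psi>_inj \<phi> that(4) by blast
        then have "\<phi> u = \<phi> v"
          using \<phi> uv that(4) by simp
        then show "u = v"
          using \<phi> uv by metis
      qed
    qed (use arc \<phi> \<psi>V that in \<open>auto simp: L_def\<close>)
    then show ?thesis
      using that by (simp add: \<phi>\<psi> L_def)
  qed
  have L_cancel: "L g = L h"
    if "L (k \<otimes> g) = L (k \<otimes> h)" "g \<in> carrier G" "h \<in> carrier G" "k \<in> carrier G" for g h k
    using L_mult[OF that(1), of "inv k"] that by (simp flip: m_assoc)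

  \<comment> \<open>Freeness of the Sylow subgroup on the layers\<close>
  have free: "q = \<one>" if q: "q \<in> P" and g: "g \<in> carrier G" and fixed: "L (q \<otimes> g) = L g" for q g
  proof -
    \<comment> \<open>The stabiliser in \<open>P\<close> of the layer of \<open>g\<close>. It is not
      all of \<open>P\<close>, whose more than four elements send \<open>g\<close> to distinct
      vertices.\<close>
    define H where "H = {a \<in> P. L (a \<otimes> g) = L g}"
    have "subgroup H G"
    proof (rule subgroupI)
      show "H \<subseteq> carrier G" "H \<noteq> {}"
        using Pc q fixed by (auto simp: H_def)
    next
      fix a assume "a \<in> H"
      then have a: "a \<in> P" "a \<in> carrier G" "L (a \<otimes> g) = L g"
        using Pc by (auto simp: H_def)
      have "L (inv a \<otimes> (a \<otimes> g)) = L (inv a \<otimes> g)"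
        using a g by (intro L_mult) auto
      then show "inv a \<in> H"
        using a g P(1) by (simp add: H_def subgroup.m_inv_closed flip: m_assoc)
    next
      fix a b assume "a \<in> H" "b \<in> H"
      then have a: "a \<in> P" "a \<in> carrier G" "L (a \<otimes> g) = L g"
        and b: "b \<in> P" "b \<in> carrier G" "L (b \<otimes> g) = L g"
        using Pc by (auto simp: H_def)
      have "L (a \<otimes> (b \<otimes> g)) = L (a \<otimes> g)"
        using a b g by (intro L_mult) auto
      then show "a \<otimes> b \<in> H"
        using a b g P(1) by (simp add: H_def subgroup.m_closed m_assoc)
    qed
    then have "H = {\<one>} \<or> H = P"
      using subgroup_of_prime_subgroup[of H P] P p by (auto simp: H_def)
    moreover have "H \<noteq> P"
    proof
      assume "H = P"
      have "\<psi> (a \<otimes> g) \<in> {L g} \<times> {..<2} \<times> {..<2}" if "a \<in> P" for a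
      proof -
        have "L (a \<otimes> g) = L g"
          using that \<open>H = P\<close> by (auto simp: H_def)
        then show ?thesis
          using \<psi>V[of "a \<otimes> g"] Pc[OF that] g unfolding L_def
          by (cases "\<psi> (a \<otimes> g)") (auto simp: Q_verts_iff)
      qed
      then have "(\<lambda>a. \<psi> (a \<otimes> g)) ` P \<subseteq> {L g} \<times> {..<2} \<times> {..<2}"
        by blast
      moreover have "inj_on (\<lambda>a. \<psi> (a \<otimes> g)) P"
      proof (rule inj_onI)
        fix a b assume "a \<in> P" "b \<in> P" "\<psi> (a \<otimes> g) = \<psi> (b \<otimes> g)"
        then have "a \<otimes> g = b \<otimes> g"
          using \<psi>_inj Pc g by blast
        then show "a = b"
          using Pc g \<open>a \<in> P\<close> \<open>b \<in> P\<close> by simp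
      qed
      ultimately have "card P \<le> card ({L g} \<times> {..<2 :: nat} \<times> {..<2 :: nat})"
        by (intro card_inj_on_le) auto
      then show False
        using P(2) n5 by simp
    qed
    ultimately show ?thesis
      using q fixed by (auto simp: H_def)
  qed
  have P_eq: "q = r" if "q \<in> P" "r \<in> P" "g \<in> carrier G" "L (q \<otimes> g) = L (r \<otimes> g)" for q r g
  proof -
    have "L (inv r \<otimes> (q \<otimes> g)) = L (inv r \<otimes> (r \<otimes> g))"
      using that Pc by (intro L_mult) auto
    then have "L (inv r \<otimes> q \<otimes> g) = L g"
      using that Pc by (simp flip: m_assoc)
    then have "inv r \<otimes> q = \<one>"
      using free[of "inv r \<otimes> q" g] that P(1)
      by (simp add: subgroup.m_closed subgroup.m_inv_closed)
    then show ?thesis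
      using that Pc by (metis inv_closed inv_equality inv_inv)
  qed

  \<comment> \<open>An element of the Sylow subgroup rotating the layers by one\<close>
  obtain g0 where g0: "g0 \<in> carrier G" "L g0 = 0"
    using \<psi>_surj[of 0 0 0] n by (force simp: L_def)
  \<comment> \<open>Distinct elements of \<open>P\<close> move layer 0 to distinct layers, so all
    \<open>n\<close> layers occur.\<close>
  have "(\<lambda>q. L (q \<otimes> g0)) ` P = {..<n}"
  proof (rule card_subset_eq)
    have "inj_on (\<lambda>q. L (q \<otimes> g0)) P"
      using P_eq g0 by (auto intro!: inj_onI)
    then show "card ((\<lambda>q. L (q \<otimes> g0)) ` P) = card {..<n}"
      using P(2) by (simp add: card_image)
  qed (use L_lt Pc g0 in auto)
  then have "1 \<in> (\<lambda>q. L (q \<otimes> g0)) ` P"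
    using n by simp
  then obtain r where r: "r \<in> P" "L (r \<otimes> g0) = 1"
    by force
  note rc = Pc[OF r(1)]
  have r0: "L (r \<otimes> h) = 1" if "h \<in> carrier G" "L h = 0" for h
    using L_mult[of h g0 r] that g0 rc r(2) by simp
  have arc_layers: "L h = L g \<or> L h = (L g + 1) mod n \<or> L g = (L h + 1) mod n"
    if "(\<psi> g, \<psi> h) \<in> parcs (Q n)" for g h
    using that n unfolding L_def by (cases "\<psi> g", cases "\<psi> h") (auto simp: Q_arc_iff)
  have near1: "L h = 0 \<or> L h = 2"
    if "(\<psi> g, \<psi> h) \<in> parcs (Q n)" "L g = 1" "L h \<noteq> 1" "h \<in> carrier G" for g h
    using arc_layers[OF that(1)] that(2,3) L_lt[OF that(4)] n by (auto simp: mod_Suc split: if_splits)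
  \<comment> \<open>The image of layer 1 is a neighbour of layer 1, which is itself the image of
    layer 0. If it were layer 0, then \<open>r\<close> would be an involution and \<open>P\<close>
    would have only two elements.\<close>
  have r1: "L (r \<otimes> h) = 2" if h: "h \<in> carrier G" "L h = 1" for h
  proof -
    obtain x y where \<psi>h: "\<psi> h = (1, x, y)" "x < 2" "y < 2"
      using \<psi>V[OF h(1)] h(2) unfolding L_def by (cases "\<psi> h") (simp add: Q_verts_iff)
    obtain g where g: "g \<in> carrier G" "\<psi> g = (0, 0, x)"
      using \<psi>_surj[of 0 0 x] \<psi>h n by auto
    have "(\<psi> g, \<psi> h) \<in> parcs (Q n)"
      using g \<psi>h n by (simp add: Q_arc_iff)
    then have "(\<psi> (r \<otimes> g), \<psi> (r \<otimes> h)) \<in> parcs (Q n)"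
      using arc g h rc by simp
    moreover have "L (r \<otimes> g) = 1"
      using r0 g by (simp add: L_def)
    moreover have "L (r \<otimes> h) \<noteq> 1"
      using L_cancel[of r g h] \<open>L (r \<otimes> g) = 1\<close> g h rc by (auto simp: L_def)
    ultimately have "L (r \<otimes> h) = 0 \<or> L (r \<otimes> h) = 2"
      using near1 h rc by simp
    moreover have "L (r \<otimes> h) \<noteq> 0"
    proof
      assume "L (r \<otimes> h) = 0"
      then have "L (r \<otimes> (r \<otimes> g0)) = L g0"
        using L_mult[of "r \<otimes> g0" h r] r(2) g0 h rc by simp
      then have "r \<otimes> r = \<one>"
        using free[of "r \<otimes> r" g0] r(1) g0 rc P(1) by (simp add: subgroup.m_closed m_assoc)
      then have "inv r = r"
        using rc by (simp add: inv_equality)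
      then have "subgroup {\<one>, r} G"
        using rc \<open>r \<otimes> r = \<one>\<close> by (intro subgroupI) auto
      then have "{\<one>, r} = {\<one>} \<or> {\<one>, r} = P"
        using P r(1) p by (intro subgroup_of_prime_subgroup) (auto simp: subgroup.one_closed)
      moreover have "r \<noteq> \<one>"
        using r(2) g0 by auto
      ultimately have "card {\<one>, r} = n"
        using P(2) by auto
      moreover have "card {\<one>, r} \<le> 2"
        by (simp add: card_insert_le_m1)
      ultimately show False
        using n by simp
    qed
    ultimately show ?thesis by simp
  qed
  \<comment> \<open>Layer \<open>n - 1\<close> neighbours layer 0, so its image neighbours layer 1,
    and layer 2 is already the image of layer 1.\<close>
  have r_last: "L (r \<otimes> h) = 0" if h: "h \<in> carrier G" "L h = n - 1" for h
  proof -
    obtain x y where \<psi>h: "\<psi> h = (n - 1, x, y)" "x < 2" "y < 2"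
      using \<psi>V[OF h(1)] h(2) unfolding L_def by (cases "\<psi> h") (simp add: Q_verts_iff)
    obtain g where g: "g \<in> carrier G" "\<psi> g = (0, y, 0)"
      using \<psi>_surj[of 0 y 0] \<psi>h n by auto
    obtain g1 where g1: "g1 \<in> carrier G" "L g1 = 1"
      using \<psi>_surj[of 1 0 0] n by (force simp: L_def)
    have "(\<psi> g, \<psi> h) \<in> parcs (Q n)"
      using g \<psi>h n by (simp add: Q_arc_iff)
    then have "(\<psi> (r \<otimes> g), \<psi> (r \<otimes> h)) \<in> parcs (Q n)"
      using arc g h rc by simp
    moreover have "L (r \<otimes> g) = 1"
      using r0 g by (simp add: L_def)
    moreover have "L (r \<otimes> h) \<noteq> 1"
      using L_cancel[of r g h] \<open>L (r \<otimes> g) = 1\<close> g h rc n by (auto simp: L_def)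
    moreover have "L (r \<otimes> h) \<noteq> 2"
      using L_cancel[of r g1 h] r1[OF g1] g1 h rc n by auto
    ultimately show ?thesis
      using near1[of "r \<otimes> g" "r \<otimes> h"] h rc by simp
  qed

  \<comment> \<open>Uniform adjacency between the vertices of layer 0 and their images\<close>
  have same: "(\<psi> h, \<psi> (r \<otimes> h)) \<in> parcs (Q n)"
    if g: "g \<in> carrier G" and adj: "(\<psi> g, \<psi> (r \<otimes> g)) \<in> parcs (Q n)"
      and h: "h \<in> carrier G" "L h = 0" for g h
  proof -
    \<comment> \<open>The element \<open>k\<close> takes \<open>g\<close> to \<open>h\<close>, and
      the conjugate \<open>q\<close> of \<open>r\<close> takes over the role of \<open>r\<close> at
      \<open>h\<close>. As \<open>q\<close> lies in \<open>P\<close> and moves layer 0 to an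
      adjacent layer, it is \<open>r\<close> or its inverse.\<close>
    define k where "k = h \<otimes> inv g"
    define q where "q = k \<otimes> r \<otimes> inv k"
    have k: "k \<in> carrier G"
      using g h by (simp add: k_def)
    have q: "q \<in> P"
      using conj[OF k r(1)] by (simp add: q_def)
    note qc = Pc[OF q]
    have kg: "k \<otimes> g = h"
      using g h by (simp add: k_def m_assoc)
    have "k \<otimes> (r \<otimes> g) = q \<otimes> (k \<otimes> g)"
    proof -
      have "q \<otimes> (k \<otimes> g) = k \<otimes> r \<otimes> (inv k \<otimes> k) \<otimes> g"
        unfolding q_def using k g rc by (simp only: m_assoc m_closed inv_closed)
      then show ?thesis
        using k g rc by (simp add: m_assoc)
    qed
    then have adj_q: "(\<psi> h, \<psi> (q \<otimes> h)) \<in> parcs (Q n)"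
      using arc[of g "r \<otimes> g" k] adj g k rc kg by simp
    have "L (q \<otimes> h) \<noteq> 0"
    proof
      assume "L (q \<otimes> h) = 0"
      then have "q = \<one>"
        using free q h by simp
      then show False
        using adj_q h n unfolding L_def
        by (cases "\<psi> h") (auto simp: Q_arc_iff)
    qed
    moreover have "L (q \<otimes> h) < n"
      using L_lt qc h by simp
    ultimately consider "L (q \<otimes> h) = 1" | "L (q \<otimes> h) = n - 1"
      using arc_layers[OF adj_q] h(2) n by (auto simp: mod_Suc split: if_splits)
    then show ?thesis
    proof cases
      case 1
      then have "q = r"
        using P_eq[of q r h] q r(1) r0 h by simp
      then show ?thesis
        using adj_q by simp
    next
      case 2
      \<comment> \<open>Here \<open>q\<close> is the inverse of \<open>r\<close>, and applying
        \<open>r\<close> to the arc yields the wanted one reversed.\<close>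
      then have "L (r \<otimes> q \<otimes> h) = L h"
        using r_last[of "q \<otimes> h"] h qc rc by (simp add: m_assoc)
      then have rq: "r \<otimes> q = \<one>"
        using free[of "r \<otimes> q" h] q r(1) P(1) h by (simp add: subgroup.m_closed)
      have "(\<psi> (r \<otimes> h), \<psi> (r \<otimes> (q \<otimes> h))) \<in> parcs (Q n)"
        using arc adj_q h qc rc by simp
      moreover have "r \<otimes> (q \<otimes> h) = h"
        using rq h qc rc by (simp flip: m_assoc)
      ultimately show ?thesis
        using Q_arc_sym by simp
    qed
  qed

  \<comment> \<open>Two vertices of layer 0 with the same image\<close>
  obtain g where g: "g \<in> carrier G" "\<psi> g = (0, 0, 0)"
    using \<psi>_surj[of 0 0 0] n by auto
  obtain h where h: "h \<in> carrier G" "\<psi> h = (0, 1, 0)"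
    using \<psi>_surj[of 0 1 0] n by auto
  \<comment> \<open>The vertex \<open>t\<close> is adjacent to both chosen vertices, whose second
    bit is 0; its image in layer 2 will force \<open>b = b'\<close>.\<close>
  obtain t where t: "t \<in> carrier G" "\<psi> t = (1, 0, 0)"
    using \<psi>_surj[of 1 0 0] n by auto
  have Lgh: "L g = 0" "L h = 0" "L t = 1"
    using g h t by (simp_all add: L_def)
  obtain a b where ab: "\<psi> (r \<otimes> g) = (1, a, b)" "a < 2" "b < 2"
    using r0[OF g(1) Lgh(1)] \<psi>V[of "r \<otimes> g"] g rc
    unfolding L_def by (cases "\<psi> (r \<otimes> g)") (simp add: Q_verts_iff)
  obtain a' b' where ab': "\<psi> (r \<otimes> h) = (1, a', b')" "a' < 2" "b' < 2"
    using r0[OF h(1) Lgh(2)] \<psi>V[of "r \<otimes> h"] h rc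
    unfolding L_def by (cases "\<psi> (r \<otimes> h)") (simp add: Q_verts_iff)
  obtain c d where cd: "\<psi> (r \<otimes> t) = (2, c, d)"
    using r1[OF t(1) Lgh(3)] unfolding L_def by (cases "\<psi> (r \<otimes> t)") simp
  have "(\<psi> (r \<otimes> g), \<psi> (r \<otimes> t)) \<in> parcs (Q n)" "(\<psi> (r \<otimes> h), \<psi> (r \<otimes> t)) \<in> parcs (Q n)"
    using arc g h t rc n by (simp_all add: Q_arc_iff)
  then have "b = c" "b' = c"
    using n5 by (auto simp: ab ab' cd Q_arc_iff mod_Suc split: if_splits)
  moreover have "(\<psi> g, \<psi> (r \<otimes> g)) \<in> parcs (Q n) \<longleftrightarrow> (\<psi> h, \<psi> (r \<otimes> h)) \<in> parcs (Q n)"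
    using same g(1) h(1) Lgh by blast
  \<comment> \<open>Both vertices have second bit 0, so adjacency to the image means that the image
    has first bit 0.\<close>
  then have "a = 0 \<longleftrightarrow> a' = 0"
    using n ab ab' g h by (simp add: Q_arc_iff mod_Suc)
  then have "a = a'"
    using ab ab' by auto
  ultimately have "\<psi> (r \<otimes> g) = \<psi> (r \<otimes> h)"
    using ab ab' by simp
  then have "r \<otimes> g = r \<otimes> h"
    using \<psi>_inj g h rc by blast
  then show False
    using g h rc by simp
qed

text \<open>Left translations are automorphisms of a Cayley graph, since the translating element
  cancels in the quotient of two vertices; pulling them back through the isomorphism gives a regular
  action.\<close>

lemma Q_not_cayley:
  assumes n: "n \<ge> 4" and p: "prime n"
  shows "\<not> is_cayley TYPE('g) (Q n)"
proof
  assume "is_cayley TYPE('g) (Q n)"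
  then obtain G :: "'g monoid" and S where G: "group G"
      and iso: "digraph_iso (with_proj (Q n)) (with_proj (cayley_graph G S))"
    unfolding is_cayley_def by blast
  interpret group G by fact
  obtain \<phi> where bij: "bij_betw \<phi> (pverts (Q n)) (pverts (cayley_graph G S))"
      and arc: "\<forall>u\<in>pverts (Q n). \<forall>v\<in>pverts (Q n).
        (\<phi> u, \<phi> v) \<in> parcs (cayley_graph G S) \<longleftrightarrow> (u, v) \<in> parcs (Q n)"
    using digraph_iso_with_projD[OF iso] by blast
  have bij': "bij_betw \<phi> (pverts (Q n)) (carrier G)"
    using bij by (simp add: cayley_graph_def)
  define \<psi> where "\<psi> = inv_into (pverts (Q n)) \<phi>"
  have \<psi>: "bij_betw \<psi> (carrier G) (pverts (Q n))"
    unfolding \<psi>_def by (rule bij_betw_inv_into[OF bij'])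
  have arc': "(\<psi> g, \<psi> h) \<in> parcs (Q n) \<longleftrightarrow> inv\<^bsub>G\<^esub> g \<otimes>\<^bsub>G\<^esub> h \<in> S"
    if "g \<in> carrier G" "h \<in> carrier G" for g h
  proof -
    have "\<psi> g \<in> pverts (Q n)" "\<psi> h \<in> pverts (Q n)"
      using \<psi> that by (auto simp: bij_betw_def)
    moreover have "\<phi> (\<psi> g) = g" "\<phi> (\<psi> h) = h"
      unfolding \<psi>_def using bij' that by (simp_all add: bij_betw_inv_into_right)
    ultimately show ?thesis
      using arc[rule_format, of "\<psi> g" "\<psi> h"] that by (simp add: cayley_graph_def)
  qed
  have "inv\<^bsub>G\<^esub> (k \<otimes>\<^bsub>G\<^esub> g) \<otimes>\<^bsub>G\<^esub> (k \<otimes>\<^bsub>G\<^esub> h) = inv\<^bsub>G\<^esub> g \<otimes>\<^bsub>G\<^esub> h"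
    if "g \<in> carrier G" "h \<in> carrier G" "k \<in> carrier G" for g h k
  proof -
    have "inv\<^bsub>G\<^esub> (k \<otimes>\<^bsub>G\<^esub> g) \<otimes>\<^bsub>G\<^esub> (k \<otimes>\<^bsub>G\<^esub> h) = inv\<^bsub>G\<^esub> g \<otimes>\<^bsub>G\<^esub> (inv\<^bsub>G\<^esub> k \<otimes>\<^bsub>G\<^esub> k) \<otimes>\<^bsub>G\<^esub> h"
      using that by (simp only: inv_mult_group m_assoc m_closed inv_closed)
    then show ?thesis
      using that by simp
  qed
  then show False
    using Q_no_regular_action[OF G p n \<psi>] arc' by simp
qed

theorem proposition3p5:
  fixes n :: nat
  assumes "n \<ge> 4"
  shows "Digraph_Component.connected (with_proj (Q n))
    \<and> is_vertex_transitive (Q n)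
    \<and> is_CIS (Q n)
    \<and> card (pverts (Q n)) = 4 * n
    \<and> has_valency (Q n) 7
    \<and> stability_number (Q n) = n
    \<and> clique_number (Q n) = 4
    \<and> (prime n \<longrightarrow> \<not> is_cayley TYPE('g) (Q n))"
  using assms Q_connected Q_is_vertex_transitive Q_is_CIS Q_card_verts Q_has_valency
    Q_stability_number Q_clique_number Q_not_cayley by blast

end
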